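(* Let $\langle K_1,\dots,K_r\rangle$ be an Alexander $r$-tuple of simplicial complexes $K_i\subsetneq 2^V$ on a finite vertex set $V$, and let $K=K_1\ast_\Delta\cdots\ast_\Delta K_r$ be its Bier complex. Then one of the following holds (with equality of complexes understood up to isomorphism): (1) $r=2$ and $K=K_1\ast_\Delta K_2=L\ast_\Delta L^\circ$ is a Bier sphere, for some complex $L\subsetneq 2^V$; or (2) $r\ge 3$ and $K=\Delta_{n,r}^{m_1,\dots,m_r;\mathbf{1}}$ is an optimal chessboard complex, where $n=m_1+\cdots+m_r+r-1$; or (3) $r\ge3$ and $K=\Delta\ast[r]^{\ast k}$, where $\Delta=\Delta_{n,r}^{m_1,\dots,m_r;\mathbf{1}}$ is an optimal chessboard complex (so $n=m_1+\cdots+m_r+r-1$) and $[r]^{\ast k}=[r]\ast\cdots\ast[r]$ is the join of $k\ge1$ copies of the $0$-dimensional complex $[r]$.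
   Context: $[n]=\{1,\dots,n\}$. A simplicial complex on a finite vertex set $V$ is a subset $K\subseteq 2^V$ with $\emptyset\in K$ that is closed under taking subsets. All complexes $K_i$ in a tuple are assumed proper: $K_i\subsetneq 2^V$. An $r$-tuple $\langle K_1,\dots,K_r\rangle$ of complexes on $V$ is collective $r$-unavoidable if for each ordered collection $(A_1,\dots,A_r)$ of pairwise disjoint subsets of $V$ there exists $i$ with $A_i\in K_i$. It is an Alexander $r$-tuple if it is collective $r$-unavoidable and, for all $A_1\in K_1,\dots,A_r\in K_r$, the set $V\setminus\bigcup_{i=1}^r A_i$ has at least $r-1$ elements. The deleted join $K_1\ast_\Delta\cdots\ast_\Delta K_r$ is the simplicial complex (with vertices in $V\times[r]$) whose simplices are $A_1\uplus\cdots\uplus A_r$ with $A_i\in K_i$ and the $A_i$ pairwise disjoint as subsets of $V$. The Bier complex of an Alexander $r$-tuple is its deleted join. The Alexander dual of $L\subsetneq 2^V$ is $L^\circ=\{F\subseteq V\mid V\setminus F\notin L\}$, and the Bier sphere of $L$ is $Bier(L)=L\ast_\Delta L^\circ$. For non-negative integers $m_1,\dots,m_r$, the multiple chessboard complex $\Delta_{n,r}^{m_1,\dots,m_r;\mathbf{1}}$ is the complex on the vertex set $[n]\times[r]$ whose simplices are the sets $S$ with $|S\cap([n]\times\{i\})|\le m_i$ for $i=1,\dots,r$ and $|S\cap(\{j\}\times[r])|\le1$ for $j=1,\dots,n$. It is called optimal if $n=m_1+\cdots+m_r+r-1$. The $0$-dimensional complex $[r]$ consists of $r$ isolated vertices,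 and $\ast$ is the join of complexes (on disjoint vertex sets). *)

theory Defs
  imports Main "HOL-Library.Disjoint_Sets"
begin

(* A complex is represented by its set of simplices; the ambient vertex set V is carried
   separately, and elements of V need not be simplices ("ghost vertices" are allowed). *)
definition simplicial_complex_on :: "'a set \<Rightarrow> 'a set set \<Rightarrow> bool" where
  "simplicial_complex_on V K \<longleftrightarrow> K \<subseteq> Pow V \<and> {} \<in> K \<and> (\<forall>A\<in>K. \<forall>B. B \<subseteq> A \<longrightarrow> B \<in> K)"

definition proper_complex_on :: "'a set \<Rightarrow> 'a set set \<Rightarrow> bool" where
  "proper_complex_on V K \<longleftrightarrow> simplicial_complex_on V K \<and> K \<noteq> Pow V"

(* The isomorphism is a bijection of the whole ambient vertex sets, ghost vertices included. *)
definition complex_iso :: "'a set \<Rightarrow> 'a set set \<Rightarrow> 'b set \<Rightarrow> 'b set set \<Rightarrow> bool" where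
  "complex_iso V K W L \<longleftrightarrow> (\<exists>f. bij_betw f V W \<and> (\<lambda>S. f ` S) ` K = L)"

(* An r-tuple is a function on nat of which only the values at 1, ..., r matter. *)
definition collective_unavoidable :: "'a set \<Rightarrow> nat \<Rightarrow> (nat \<Rightarrow> 'a set set) \<Rightarrow> bool" where
  "collective_unavoidable V r K \<longleftrightarrow>
     (\<forall>A. (\<forall>i\<in>{1..r}. A i \<subseteq> V) \<and> disjoint_family_on A {1..r} \<longrightarrow> (\<exists>i\<in>{1..r}. A i \<in> K i))"

definition alexander_tuple :: "'a set \<Rightarrow> nat \<Rightarrow> (nat \<Rightarrow> 'a set set) \<Rightarrow> bool" where
  "alexander_tuple V r K \<longleftrightarrow>
     collective_unavoidable V r K \<and>
     (\<forall>A. (\<forall>i\<in>{1..r}. A i \<in> K i) \<longrightarrow> card (V - (\<Union>i\<in>{1..r}. A i)) \<ge> r - 1)"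

(* The copy of A i in the deleted join is A i \<times> {i}; the ambient vertex set is V \<times> {1..r}. *)
definition deleted_join :: "nat \<Rightarrow> (nat \<Rightarrow> 'a set set) \<Rightarrow> ('a \<times> nat) set set" where
  "deleted_join r K =
     {(\<Union>i\<in>{1..r}. A i \<times> {i}) | A. (\<forall>i\<in>{1..r}. A i \<in> K i) \<and> disjoint_family_on A {1..r}}"

definition alexander_dual :: "'a set \<Rightarrow> 'a set set \<Rightarrow> 'a set set" where
  "alexander_dual V L = {F. F \<subseteq> V \<and> V - F \<notin> L}"

definition bier_sphere :: "'a set \<Rightarrow> 'a set set \<Rightarrow> ('a \<times> nat) set set" where
  "bier_sphere V L = deleted_join 2 (\<lambda>i. if i = 1 then L else alexander_dual V L)"

definition chessboard :: "nat \<Rightarrow> nat \<Rightarrow> (nat \<Rightarrow> nat) \<Rightarrow> (nat \<times> nat) set set" where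
  "chessboard n r m =
     {S. S \<subseteq> {1..n} \<times> {1..r} \<and>
         (\<forall>i\<in>{1..r}. card (S \<inter> ({1..n} \<times> {i})) \<le> m i) \<and>
         (\<forall>j\<in>{1..n}. card (S \<inter> ({j} \<times> {1..r})) \<le> 1)}"

(* The ambient vertex set of the join is the disjoint union V <+> W. *)
definition complex_join :: "'a set set \<Rightarrow> 'b set set \<Rightarrow> ('a + 'b) set set" where
  "complex_join K L = {A <+> B | A B. A \<in> K \<and> B \<in> L}"

(* The j-th copy of K lives on V \<times> {j}; the ambient vertex set is V \<times> {1..k}. *)
definition join_power :: "'a set set \<Rightarrow> nat \<Rightarrow> ('a \<times> nat) set set" where
  "join_power K k = {(\<Union>j\<in>{1..k}. B j \<times> {j}) | B. \<forall>j\<in>{1..k}. B j \<in> K}"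

definition isolated_points :: "nat \<Rightarrow> nat set set" where
  "isolated_points r = insert {} ((\<lambda>i. {i}) ` {1..r})"

end

theory Submission
  imports Defs
begin

text \<open>
  A facet of the Bier complex is a family of disjoint \<open>A\<^sub>i \<in> K\<^sub>i\<close> leaving a set \<open>C\<close> of exactly \<open>r - 1\<close>
  vertices uncovered. Distributing \<open>C \<union> {v}\<close> over the \<open>r\<close> colours, for a vertex \<open>v \<in> A\<^sub>i\<close>, shows that
  for all \<open>j \<noteq> i\<close> and \<open>c \<in> C\<close> exactly one of \<open>A\<^sub>j \<union> {v} \<in> K\<^sub>j\<close> and \<open>A\<^sub>i - {v} \<union> {c} \<in> K\<^sub>i\<close> holds. Hence every
  vertex either can be moved to any other colour or can be exchanged with any uncovered vertex.
  For \<open>r \<ge> 3\<close> the set \<open>U\<close> of movable vertices is not changed by these moves, since a third colour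
  class stays untouched. As all distributions of \<open>V - U\<close> with given class sizes are
  reachable, \<open>K\<^sub>i\<close> consists of the sets \<open>B\<close> with \<open>|B - U| \<le> m\<^sub>i\<close>, so \<open>V - U\<close> gives the chessboard and
  each vertex of \<open>U\<close> a factor \<open>[r]\<close>.
\<close>

section \<open>Colourings, facets and their maximality\<close>

locale alexander =
  fixes V :: "'a set" and r :: nat and K :: "nat \<Rightarrow> 'a set set"
  assumes fin: "finite V"
    and r3: "3 \<le> r"
    and complexes: "\<And>i. i \<in> {1..r} \<Longrightarrow> simplicial_complex_on V (K i)"
    and alex: "alexander_tuple V r K"
begin

text \<open>A family of disjoint sets is coded by a colouring of \<open>V\<close>, with colour 0 for the uncovered vertices.\<close>
definition fib :: "('a \<Rightarrow> nat) \<Rightarrow> nat \<Rightarrow> 'a set" where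
  "fib h i = {v\<in>V. h v = i}"

definition admissible :: "('a \<Rightarrow> nat) \<Rightarrow> bool" where
  "admissible h \<longleftrightarrow> (\<forall>v\<in>V. h v \<le> r) \<and> (\<forall>i\<in>{1..r}. fib h i \<in> K i)"

text \<open>By \<open>card_fib_0_ge\<close> no admissible colouring leaves fewer than
  \<open>r - 1\<close> vertices uncovered, so these are the simplices of largest size.\<close>

definition facet :: "('a \<Rightarrow> nat) \<Rightarrow> bool" where
  "facet h \<longleftrightarrow> admissible h \<and> card (fib h 0) = r - 1"

text \<open>Only one other colour is required to accept \<open>v\<close>; for facets
  \<open>movable_iff\<close> shows that then every other colour accepts it.\<close>

definition movable :: "('a \<Rightarrow> nat) \<Rightarrow> 'a set" where
  "movable h = {v\<in>V. \<exists>j\<in>{1..r}. j \<noteq> h v \<and> insert v (fib h j) \<in> K j}"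

lemma down_closed: "i \<in> {1..r} \<Longrightarrow> A \<in> K i \<Longrightarrow> B \<subseteq> A \<Longrightarrow> B \<in> K i"
  using complexes[of i] unfolding simplicial_complex_on_def by blast

lemma subset_V: "i \<in> {1..r} \<Longrightarrow> A \<in> K i \<Longrightarrow> A \<subseteq> V"
  using complexes[of i] unfolding simplicial_complex_on_def by blast

lemma empty_in: "i \<in> {1..r} \<Longrightarrow> {} \<in> K i"
  using complexes[of i] unfolding simplicial_complex_on_def by blast

lemma finite_fib [simp]: "finite (fib h i)"
  using fin by (simp add: fib_def)

lemma fib_upd: "v \<in> V \<Longrightarrow> fib (h(v := j)) i = (if i = j then insert v (fib h i) else fib h i - {v})"
  by (auto simp: fib_def)

lemma fib_cong: "(\<And>v. v \<in> V \<Longrightarrow> g v = h v) \<Longrightarrow> fib g i = fib h i"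
  by (auto simp: fib_def)

lemma unavoidable: "\<exists>i\<in>{1..r}. fib h i \<in> K i"
proof -
  have "(\<forall>i\<in>{1..r}. fib h i \<subseteq> V) \<and> disjoint_family_on (fib h) {1..r}"
    by (auto simp: fib_def disjoint_family_on_def)
  then show ?thesis
    using alex unfolding alexander_tuple_def collective_unavoidable_def by blast
qed

lemma card_fib_0_ge: "admissible h \<Longrightarrow> r - 1 \<le> card (fib h 0)"
proof -
  assume h: "admissible h"
  then have "fib h 0 = V - (\<Union>i\<in>{1..r}. fib h i)"
    by (auto simp: fib_def admissible_def)
  then show ?thesis
    using alex h unfolding alexander_tuple_def admissible_def by metis
qed

text \<open>An admissible colouring with fewest uncovered vertices is a facet. If \<open>r\<close>
  vertices were uncovered, each colour could be offered one of them, and unavoidability names a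
  colour that can keep its gift.\<close>

lemma facet_exists: "\<exists>g. facet g"
proof -
  have "admissible (\<lambda>_. 0)"
    by (auto simp: admissible_def fib_def empty_in)
  then obtain g where g: "admissible g"
    and min: "\<And>h. admissible h \<Longrightarrow> card (fib g 0) \<le> card (fib h 0)"
    using ex_has_least_nat[of admissible _ "\<lambda>h. card (fib h 0)"] by blast
  have "card (fib g 0) < r"
  proof (rule ccontr)
    assume "\<not> card (fib g 0) < r"
    then have "card {1..r} \<le> card (fib g 0)" by simp
    then obtain p where p: "p ` {1..r} \<subseteq> fib g 0" "inj_on p {1..r}"
      using card_le_inj[of "{1..r}" "fib g 0"] by auto
    define h where "h v = (if v \<in> p ` {1..r} then the_inv_into {1..r} p v else g v)" for v
    have hp: "h (p i) = i" if "i \<in> {1..r}" for i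
      using that p by (simp add: h_def the_inv_into_f_f)
    obtain k where k: "k \<in> {1..r}" "fib h k \<in> K k" using unavoidable by blast
    have pk: "p k \<in> V" "g (p k) = 0" using p k(1) by (auto simp: fib_def image_subset_iff)
    have gp: "g x = k \<Longrightarrow> x \<notin> p ` {1..r}" for x
      using p k(1) by (auto simp: fib_def image_subset_iff)
    have "insert (p k) (fib g k) \<subseteq> fib h k"
      using pk hp[OF k(1)] gp by (auto simp: fib_def h_def)
    then have "insert (p k) (fib g k) \<in> K k" using k down_closed by blast
    moreover have "fib g i - {p k} \<in> K i" if "i \<in> {1..r}" for i
      using down_closed[of i "fib g i"] g that by (auto simp: admissible_def)
    \<comment> \<open>Only \<open>p k\<close> is recoloured: \<open>h\<close> itself need not be
      admissible, since unavoidability vouches for the single class \<open>k\<close>.\<close>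
    ultimately have "admissible (g(p k := k))"
      using g k pk unfolding admissible_def by (auto simp: fib_upd)
    from min[OF this] have "card (fib g 0) \<le> card (fib g 0 - {p k})"
      using k pk by (simp add: fib_upd)
    moreover have "p k \<in> fib g 0" using pk by (simp add: fib_def)
    ultimately show False
      by (metis card_Diff1_less finite_fib not_le)
  qed
  with card_fib_0_ge[OF g] g have "facet g" by (simp add: facet_def)
  then show ?thesis by blast
qed

lemma facet_fib: "facet g \<Longrightarrow> i \<in> {1..r} \<Longrightarrow> fib g i \<in> K i"
  by (simp add: facet_def admissible_def)

lemma facet_zero: "facet g \<Longrightarrow> \<exists>c\<in>V. g c = 0"
proof -
  assume "facet g"
  then have "fib g 0 \<noteq> {}" using r3 by (auto simp: facet_def)
  then show ?thesis by (auto simp: fib_def)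
qed

text \<open>Otherwise giving \<open>c\<close> the colour \<open>k\<close> would leave only
  \<open>r - 2\<close> vertices uncovered, against \<open>card_fib_0_ge\<close>.\<close>

lemma facet_maximal:
  assumes "facet g" "c \<in> V" "g c = 0" "k \<in> {1..r}"
  shows "insert c (fib g k) \<notin> K k"
proof
  assume *: "insert c (fib g k) \<in> K k"
  have "fib g i - {c} \<in> K i" if "i \<in> {1..r}" for i
    using down_closed[of i "fib g i"] facet_fib[OF assms(1)] that by auto
  then have "admissible (g(c := k))"
    using assms * by (auto simp: facet_def admissible_def fib_upd)
  from card_fib_0_ge[OF this] have "r - 1 \<le> card (fib g 0 - {c})"
    using assms by (simp add: fib_upd)
  moreover have "c \<in> fib g 0" using assms by (simp add: fib_def)
  ultimately show False
    using assms(1) by (metis card_Diff1_less facet_def finite_fib not_le)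
qed

section \<open>The exchange alternative and movability\<close>

lemma exchange:
  assumes g: "facet g" and v: "v \<in> V" "g v \<noteq> 0" and c: "c \<in> V" "g c = 0"
    and j: "j \<in> {1..r}" "j \<noteq> g v"
  shows "insert v (fib g j) \<in> K j \<longleftrightarrow> insert c (fib g (g v) - {v}) \<notin> K (g v)"
proof -
  let ?i = "g v"
  have i: "?i \<in> {1..r}" using g v by (auto simp: facet_def admissible_def Suc_le_eq)
  have "v \<noteq> c" using v c by auto
  have 1: "False" if "insert v (fib g j) \<in> K j" "insert c (fib g ?i - {v}) \<in> K ?i"
  proof -
    \<comment> \<open>If both changes were allowed, making them together would cover
      \<open>c\<close> without uncovering anything.\<close>
    let ?h = "g(v := j, c := ?i)"
    have h: "fib ?h k = (if k = ?i then insert c (fib g ?i - {v}) else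
        if k = j then insert v (fib g j) else fib g k - {c})" for k
      using v c j \<open>v \<noteq> c\<close> by (auto simp: fib_def)
    have "fib g k - {c} \<in> K k" if "k \<in> {1..r}" for k
      using down_closed[of k "fib g k"] facet_fib[OF g] that by auto
    then have "admissible ?h"
      using that g i j unfolding admissible_def h by (auto simp: facet_def admissible_def)
    then have "r - 1 \<le> card (fib g 0 - {c})"
      using card_fib_0_ge[of ?h] v j unfolding h by auto
    moreover have "c \<in> fib g 0" using c by (simp add: fib_def)
    ultimately show False
      using g by (metis card_Diff1_less facet_def finite_fib not_le)
  qed
  have 2: "insert v (fib g j) \<in> K j \<or> insert c (fib g ?i - {v}) \<in> K ?i"
  proof -
    let ?C = "fib g 0 - {c}" and ?R = "{1..r} - {?i, j}"
    have "c \<in> fib g 0" using c by (simp add: fib_def)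
    then have "card ?C = r - 2" using g by (simp add: facet_def)
    also have "r - 2 = card ?R"
      using i j by (subst card_Diff_subset) auto
    finally obtain p where p: "bij_betw p ?C ?R"
      using finite_same_card_bij[of ?C ?R] by auto
    \<comment> \<open>This colouring leaves nothing uncovered: \<open>v\<close> gets
      \<open>j\<close>, \<open>c\<close> gets the old colour of \<open>v\<close>, and the other
      \<open>r - 2\<close> uncovered vertices receive the other \<open>r - 2\<close> colours, one
      each.\<close>
    define h where "h x = (if x = v then j else if x = c then ?i
        else if g x = 0 then p x else g x)" for x
    obtain k where k: "k \<in> {1..r}" "fib h k \<in> K k" using unavoidable by blast
    have pr: "p x \<in> ?R" if "x \<in> V" "g x = 0" "x \<noteq> c" for x
      using p that by (auto simp: bij_betw_def fib_def)
    consider "k = ?i" | "k = j" | "k \<in> ?R" using k(1) by blast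
    then show ?thesis
    proof cases
      case 1
      have "insert c (fib g ?i - {v}) \<subseteq> fib h k"
        using 1 c v \<open>v \<noteq> c\<close> by (auto simp: fib_def h_def)
      then show ?thesis using k 1 down_closed by blast
    next
      case 2
      have "insert v (fib g j) \<subseteq> fib h k"
        using 2 c v j \<open>v \<noteq> c\<close> by (auto simp: fib_def h_def)
      then show ?thesis using k 2 down_closed by blast
    next
      \<comment> \<open>Such a class has gained an uncovered vertex, which
        \<open>facet_maximal\<close> forbids, so unavoidability must pick \<open>?i\<close> or
        \<open>j\<close>.\<close>
      case 3
      then obtain x where x: "x \<in> ?C" "p x = k" using p by (metis bij_betw_def imageE)
      have "insert x (fib g k) \<subseteq> fib h k"
        using 3 x c v k(1) \<open>v \<noteq> c\<close> by (auto simp: fib_def h_def)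
      then have "insert x (fib g k) \<in> K k" using k down_closed by blast
      then show ?thesis using facet_maximal[OF g _ _ k(1), of x] x by (auto simp: fib_def)
    qed
  qed
  show ?thesis using 1 2 by blast
qed

text \<open>The right-hand side of \<open>exchange\<close> does not depend on \<open>j\<close>, so
  acceptance by one new colour implies acceptance by all. For uncovered \<open>v\<close> both sides
  are false by maximality.\<close>

lemma movable_iff:
  assumes g: "facet g" and v: "v \<in> V" and j: "j \<in> {1..r}" "j \<noteq> g v"
  shows "v \<in> movable g \<longleftrightarrow> insert v (fib g j) \<in> K j"
proof (cases "g v = 0")
  case True
  then show ?thesis using facet_maximal[OF g v] j v by (auto simp: movable_def)
next
  case False
  obtain c where c: "c \<in> V" "g c = 0" using facet_zero[OF g] by blast
  show ?thesis
    using exchange[OF g v False c] j v unfolding movable_def by blast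
qed

lemma movable_nonzero: "facet g \<Longrightarrow> v \<in> movable g \<Longrightarrow> g v \<noteq> 0"
  using facet_maximal[of g v] unfolding movable_def by blast

lemma movable_subset: "movable g \<subseteq> V"
  by (auto simp: movable_def)

lemma not_movable_maximal:
  assumes "facet g" "v \<in> V" "v \<notin> movable g" "i \<in> {1..r}" "i \<noteq> g v"
  shows "insert v (fib g i) \<notin> K i"
  using assms by (auto simp: movable_def)

section \<open>Moves and swaps that preserve the movable set\<close>

text \<open>The decisive use of \<open>r3\<close>: a class untouched by a change of two colours
  serves to test movability before and after.\<close>

lemma third_index: "\<exists>k\<in>{1..r}. k \<noteq> a \<and> k \<noteq> (b::nat)"
proof -
  have "card {a, b} < card {1..r}" using r3 by (simp add: card_insert_if)
  then have "\<not> {1..r} \<subseteq> {a, b}" using card_mono[of "{a,b}" "{1..r}"] by fastforce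
  then show ?thesis by blast
qed

text \<open>Movability can be tested at any colour other than the present one, and a smaller class
  accepts at least what a larger one does.\<close>

lemma movable_transfer:
  assumes "facet g" "facet h" "b \<in> V" "k \<in> {1..r}" "k \<noteq> g b" "k \<noteq> h b" "fib h k \<subseteq> fib g k"
    "b \<in> movable g"
  shows "b \<in> movable h"
proof -
  have "insert b (fib g k) \<in> K k" using assms movable_iff by blast
  then have "insert b (fib h k) \<in> K k" using assms down_closed by (meson insert_mono)
  then show ?thesis using assms movable_iff by blast
qed

lemma move:
  assumes g: "facet g" and v: "v \<in> movable g" and j: "j \<in> {1..r}"
  shows "facet (g(v := j)) \<and> movable (g(v := j)) = movable g"
proof (cases "j = g v")
  case True
  then show ?thesis using g by simp
next
  case False
  let ?h = "g(v := j)" and ?i = "g v"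
  have vV: "v \<in> V" using v by (simp add: movable_def)
  have i0: "?i \<noteq> 0" using movable_nonzero g v by blast
  have i: "?i \<in> {1..r}" using g vV i0 by (auto simp: facet_def admissible_def Suc_le_eq)
  have "fib g i - {v} \<in> K i" if "i \<in> {1..r}" for i
    using down_closed[of i "fib g i"] facet_fib[OF g] that by auto
  moreover have "insert v (fib g j) \<in> K j" using movable_iff[OF g vV j False] v by blast
  ultimately have "admissible ?h"
    using g vV j by (auto simp: facet_def admissible_def fib_upd)
  moreover have "fib ?h 0 = fib g 0" using vV j i0 by (auto simp: fib_upd fib_def)
  ultimately have h: "facet ?h" using g by (simp add: facet_def)
  have "b \<in> movable g \<longleftrightarrow> b \<in> movable ?h" if b: "b \<in> V" for b
  proof (cases "b = v")
    case True
    \<comment> \<open>Returning \<open>v\<close> to its old colour restores a class of the facet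
      \<open>g\<close>, so \<open>v\<close> stays movable.\<close>
    have "insert v (fib ?h ?i) = fib g ?i" using vV False by (auto simp: fib_def)
    then have "v \<in> movable ?h" using movable_iff[OF h vV i] False facet_fib[OF g i] by simp
    then show ?thesis using True v by simp
  next
    case bv: False
    then have hb: "?h b = g b" by simp
    \<comment> \<open>If \<open>b\<close> has the old or the new colour of \<open>v\<close>, a third
      class is unchanged and decides both directions. Otherwise for \<open>r = 3\<close> no
      unchanged class avoids \<open>b\<close>, so the forward direction is tested at
      \<open>?i\<close>, which shrinks, and the backward one at \<open>j\<close>, which
      grows.\<close>
    show ?thesis
    proof (cases "g b = ?i \<or> g b = j")
      case True
      obtain k where k: "k \<in> {1..r}" "k \<noteq> ?i" "k \<noteq> j" using third_index by blast
      then have "fib ?h k = fib g k" by (auto simp: fib_def)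
      then show ?thesis
        using movable_transfer[OF g h b k(1)] movable_transfer[OF h g b k(1)] k hb True by auto
    next
      case False
      have "fib ?h ?i \<subseteq> fib g ?i" "fib g j \<subseteq> fib ?h j"
        using \<open>j \<noteq> ?i\<close> by (auto simp: fib_def)
      then show ?thesis
        using movable_transfer[OF g h b i] movable_transfer[OF h g b j] hb False by auto
    qed
  qed
  then have "movable ?h = movable g" using movable_subset by blast
  with h show ?thesis by blast
qed

definition swap :: "('a \<Rightarrow> nat) \<Rightarrow> 'a \<Rightarrow> 'a \<Rightarrow> 'a \<Rightarrow> nat" where
  "swap g a b = g(a := g b, b := g a)"

text \<open>For a covered \<open>v\<close> that is not movable, \<open>exchange\<close> leaves only
  its other alternative: the uncovered \<open>c\<close> may replace \<open>v\<close> in its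
  class.\<close>

lemma swap_zero:
  assumes g: "facet g" and v: "v \<in> V - movable g" and c: "c \<in> V" "g c = 0"
  shows "facet (swap g v c) \<and> movable (swap g v c) = movable g"
proof (cases "g v = 0")
  case True
  then have "swap g v c = g" using c by (auto simp: swap_def)
  then show ?thesis using g by simp
next
  case v0: False
  let ?h = "swap g v c" and ?i = "g v"
  have "v \<noteq> c" using v0 c by auto
  have vV: "v \<in> V" using v by simp
  have i: "?i \<in> {1..r}" using g vV v0 by (auto simp: facet_def admissible_def Suc_le_eq)
  have hfib: "fib ?h k = (if k = ?i then insert c (fib g ?i - {v}) else
        if k = 0 then insert v (fib g 0 - {c}) else fib g k)" for k
    using v c v0 \<open>v \<noteq> c\<close> by (auto simp: fib_def swap_def)
  obtain j where j: "j \<in> {1..r}" "j \<noteq> ?i" using third_index by blast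
  have "insert c (fib g ?i - {v}) \<in> K ?i"
    using exchange[OF g vV v0 c j] movable_iff[OF g vV j] v by blast
  then have "admissible ?h"
    using g i c unfolding admissible_def hfib
    by (auto simp: facet_def admissible_def swap_def)
  moreover have "c \<in> fib g 0" "v \<notin> fib g 0" using c v0 by (auto simp: fib_def)
  then have "card (fib ?h 0) = card (fib g 0)"
    using v0 card.remove[of "fib g 0" c] unfolding hfib
    by (auto simp del: card_Diff_insert card_Diff_singleton)
  ultimately have h: "facet ?h" using g by (simp add: facet_def)
  have "b \<in> movable g \<longleftrightarrow> b \<in> movable ?h" if b: "b \<in> V" for b
  proof -
    \<comment> \<open>After the swap \<open>v\<close> is uncovered, hence not movable. Class
      \<open>j\<close> is unchanged and refused \<open>c\<close> by maximality of \<open>g\<close>.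
      Any other vertex is tested at an unchanged third class.\<close>
    consider "b = v" | "b = c" | "b \<noteq> v" "b \<noteq> c" by blast
    then show ?thesis
    proof cases
      case 1
      then have "?h b = 0" using c \<open>v \<noteq> c\<close> by (simp add: swap_def)
      then show ?thesis using movable_nonzero[OF h] 1 v by blast
    next
      case 2
      have hc: "?h c = ?i" by (simp add: swap_def)
      have "fib ?h j = fib g j" using j hfib by auto
      then have "c \<notin> movable ?h"
        using movable_iff[OF h c(1), of j] facet_maximal[OF g c j(1)] hc j by auto
      then show ?thesis using 2 c movable_nonzero[OF g] by blast
    next
      case 3
      then have hb: "?h b = g b" by (simp add: swap_def)
      obtain k where k: "k \<in> {1..r}" "k \<noteq> ?i" "k \<noteq> g b" using third_index by blast
      then have "fib ?h k = fib g k" by (auto simp: hfib)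
      then show ?thesis
        using movable_transfer[OF g h b k(1)] movable_transfer[OF h g b k(1)] k hb by auto
    qed
  qed
  then have "movable ?h = movable g" using movable_subset by blast
  with h show ?thesis by blast
qed

lemma swap_commute: "swap g a b = swap g b a"
  by (rule ext) (simp add: swap_def)

text \<open>A transposition (a b) is the product of (a c), (b a), (b c) for an unused vertex c.\<close>
lemma swap_facet:
  assumes g: "facet g" and a: "a \<in> V - movable g" and b: "b \<in> V - movable g"
  shows "facet (swap g a b) \<and> movable (swap g a b) = movable g"
proof (cases "a = b \<or> g a = 0 \<or> g b = 0")
  case True
  then consider "a = b" | "g b = 0" | "g a = 0" by metis
  then show ?thesis
  proof cases
    case 1
    then show ?thesis using g by (simp add: swap_def)
  next
    case 2
    then show ?thesis using swap_zero[OF g a] b by blast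
  next
    case 3
    then show ?thesis
      unfolding swap_commute[of g a b] using swap_zero[OF g b] a by blast
  qed
next
  case False
  obtain c where c: "c \<in> V" "g c = 0" using facet_zero[OF g] by blast
  have ne: "a \<noteq> b" "a \<noteq> c" "b \<noteq> c" using False c by auto
  have cU: "c \<notin> movable g" using movable_nonzero[OF g] c by blast
  define g1 where "g1 = swap g a c"
  define g2 where "g2 = swap g1 b a"
  have 1: "facet g1" "movable g1 = movable g" using swap_zero[OF g a c] by (auto simp: g1_def)
  have "g1 a = 0" using c ne by (simp add: g1_def swap_def)
  then have 2: "facet g2" "movable g2 = movable g"
    using swap_zero[of g1 b a] 1 a b by (auto simp: g2_def)
  have "g2 b = 0" using \<open>g1 a = 0\<close> ne by (simp add: g2_def swap_def)
  then have 3: "facet (swap g2 c b) \<and> movable (swap g2 c b) = movable g"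
    using swap_zero[of g2 c b] 2 b c cU by auto
  have "swap g2 c b = swap g a b"
    using ne by (auto simp: g2_def g1_def swap_def fun_eq_iff c)
  with 3 show ?thesis by simp
qed

lemma card_swap:
  assumes "a \<in> W" "b \<in> W"
  shows "card {w\<in>W. swap g a b w = i} = card {w\<in>W. g w = i}"
proof (rule bij_betw_same_card)
  show "bij_betw (id(a := b, b := a)) {w\<in>W. swap g a b w = i} {w\<in>W. g w = i}"
    using assms
    by (intro bij_betw_byWitness[where f' = "id(a := b, b := a)"])
       (auto simp: swap_def split: if_splits)
qed

section \<open>Reachability and the shape of the complexes\<close>

text \<open>Induction on the number of wrongly coloured vertices: a wrong vertex of \<open>U\<close>
  is corrected by one move, a wrong vertex outside \<open>U\<close> by a swap. Neither operation
  changes the colour counts on \<open>V - U\<close>.\<close>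

lemma facet_reachable:
  assumes "facet g" "movable g = U" "\<And>v. v \<in> V \<Longrightarrow> h v \<le> r" "\<And>v. v \<in> U \<Longrightarrow> h v \<noteq> 0"
    "\<And>i. card {w\<in>V - U. g w = i} = card {w\<in>V - U. h w = i}"
  shows "facet h \<and> movable h = U"
  using assms
proof (induction "card {v\<in>V. g v \<noteq> h v}" arbitrary: g rule: less_induct)
  case less
  note IH = less.hyps and g = less.prems(1,2) and h = less.prems(3,4) and cards = less.prems(5)
  have smaller: "card {v\<in>V. g' v \<noteq> h v} < card {v\<in>V. g v \<noteq> h v}"
    if "{v\<in>V. g' v \<noteq> h v} \<subset> {v\<in>V. g v \<noteq> h v}" for g'
    using that fin by (intro psubset_card_mono) auto
  have UV: "U \<subseteq> V" using g by (auto simp: movable_def)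
  consider v where "v \<in> U" "g v \<noteq> h v" | w where "w \<in> V - U" "g w \<noteq> h w" | "\<forall>v\<in>V. g v = h v"
    by blast
  then show ?case
  proof cases
    case 1
    have "v \<in> V" using 1 UV by blast
    then have "h v \<in> {1..r}" using h 1 by (simp add: Suc_le_eq)
    then have *: "facet (g(v := h v)) \<and> movable (g(v := h v)) = U"
      using move[of g v "h v"] g 1 by auto
    have c: "card {w\<in>V - U. (g(v := h v)) w = i} = card {w\<in>V - U. h w = i}" for i
    proof -
      have "{w\<in>V - U. (g(v := h v)) w = i} = {w\<in>V - U. g w = i}" using 1 by auto
      then show ?thesis using cards by metis
    qed
    have "{x\<in>V. (g(v := h v)) x \<noteq> h x} \<subset> {v\<in>V. g v \<noteq> h v}"
      using 1 \<open>v \<in> V\<close> by auto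
    then show ?thesis
      using IH[OF smaller, of "g(v := h v)"] * c h by blast
  next
    case 2
    \<comment> \<open>The equal counts provide a vertex that wrongly holds the colour wanted by
      \<open>w\<close>. Swapping with it corrects \<open>w\<close> and damages nothing, as
      \<open>a\<close> was wrong already.\<close>
    have "\<exists>a\<in>V - U. g a = h w \<and> h a \<noteq> h w"
    proof (rule ccontr)
      assume "\<not> ?thesis"
      then have "{x\<in>V - U. g x = h w} \<subset> {x\<in>V - U. h x = h w}" using 2 by auto
      then have "card {x\<in>V - U. g x = h w} < card {x\<in>V - U. h x = h w}"
        using fin by (intro psubset_card_mono) auto
      then show False using cards by simp
    qed
    then obtain a where a: "a \<in> V - U" "g a = h w" "h a \<noteq> h w" by blast
    have *: "facet (swap g w a) \<and> movable (swap g w a) = U"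
      using swap_facet[of g w a] g 2 a by auto
    have c: "card {x\<in>V - U. swap g w a x = i} = card {w\<in>V - U. h w = i}" for i
      using card_swap[of w "V - U" a g i] 2 a cards by auto
    have "{x\<in>V. swap g w a x \<noteq> h x} \<subset> {v\<in>V. g v \<noteq> h v}"
      using 2 a by (auto simp: swap_def split: if_splits)
    then show ?thesis
      using IH[OF smaller, of "swap g w a"] * c h by blast
  next
    case 3
    then have "fib g i = fib h i" for i by (intro fib_cong) auto
    moreover have "admissible g \<longleftrightarrow> admissible h"
      using 3 calculation by (auto simp: admissible_def)
    moreover have "movable g = movable h"
      using 3 calculation(1) by (auto simp: movable_def)
    ultimately show ?thesis using g by (auto simp: facet_def)
  qed
qed

text \<open>\<open>U\<close> is the movable set of one facet and \<open>m i\<close> counts its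
  unmovable vertices of colour \<open>i\<close>. The summand \<open>r - 1\<close> comes from the
  uncovered vertices, none of which is movable.\<close>

lemma tuple_structure:
  "\<exists>U m. U \<subseteq> V \<and> card (V - U) = (\<Sum>i=1..r. m i) + r - 1 \<and>
     (\<forall>i\<in>{1..r}. K i = {B. B \<subseteq> V \<and> card (B - U) \<le> m i})"
proof -
  obtain g where g: "facet g" using facet_exists by blast
  define U where "U = movable g"
  define W where "W = V - U"
  define m where "m i = card {w\<in>W. g w = i}" for i
  have UV: "U \<subseteq> V" by (auto simp: U_def movable_def)
  have finW: "finite W" using fin by (simp add: W_def)
  have "w \<notin> U" if "g w = 0" for w
    using movable_nonzero[OF g] that unfolding U_def by blast
  then have "fib g 0 = {w\<in>W. g w = 0}"
    by (auto simp: fib_def W_def)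
  then have m0: "m 0 = r - 1" using g by (simp add: m_def facet_def)
  have "card W = (\<Sum>i\<in>{0..r}. m i)"
  proof -
    have "W = (\<Union>i\<in>{0..r}. {w\<in>W. g w = i})"
      using g by (auto simp: facet_def admissible_def W_def)
    then have "card W = card (\<Union>i\<in>{0..r}. {w\<in>W. g w = i})" by simp
    also have "\<dots> = (\<Sum>i\<in>{0..r}. m i)"
      unfolding m_def using finW by (subst card_UN_disjoint) auto
    finally show ?thesis .
  qed
  then have cardW: "card W = (\<Sum>i=1..r. m i) + r - 1"
    using r3 by (simp add: sum.atLeast_Suc_atMost m0)
  \<comment> \<open>A permutation \<open>f\<close> of \<open>W\<close> carries \<open>B\<close> onto
    the class \<open>i\<close> of \<open>g\<close>; colouring \<open>W\<close> by \<open>g\<close>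
    after \<open>f\<close> keeps all counts, so \<open>facet_reachable\<close> applies. On
    \<open>U\<close> the colour is \<open>i\<close> on \<open>X\<close> and some other nonzero
    \<open>k\<close> elsewhere.\<close>
  have prescribe: "\<exists>h. facet h \<and> movable h = U \<and> fib h i = B \<union> X"
    if i: "i \<in> {1..r}" and B: "B \<subseteq> W" "card B = m i" and X: "X \<subseteq> U" for i B X
  proof -
    let ?G = "{w\<in>W. g w = i}"
    have "finite B" "finite ?G" using B finW finite_subset by auto
    then obtain p where p: "bij_betw p B ?G"
      using finite_same_card_bij[of B ?G] B by (auto simp: m_def)
    have "card (W - B) = card (W - ?G)"
      using B finW \<open>finite B\<close> by (simp add: card_Diff_subset m_def)
    then obtain q where q: "bij_betw q (W - B) (W - ?G)"
      using finite_same_card_bij[of "W - B" "W - ?G"] finW by auto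
    define f where "f x = (if x \<in> B then p x else q x)" for x
    have "bij_betw f B ?G" using p by (simp add: f_def cong: bij_betw_cong)
    moreover have "bij_betw f (W - B) (W - ?G)"
      using q bij_betw_cong[of "W - B" f q "W - ?G"] by (auto simp: f_def)
    ultimately have "bij_betw f (B \<union> (W - B)) (?G \<union> (W - ?G))"
      by (intro bij_betw_combine) auto
    moreover have "B \<union> (W - B) = W" "?G \<union> (W - ?G) = W" using B by auto
    ultimately have f: "bij_betw f W W" by simp
    have fB: "x \<in> W \<Longrightarrow> g (f x) = i \<longleftrightarrow> x \<in> B" for x
      using p q by (auto simp: f_def bij_betw_def)
    obtain k where k: "k \<in> {1..r}" "k \<noteq> i" using third_index by blast
    define h where "h x = (if x \<in> W then g (f x) else if x \<in> X then i else k)" for x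
    have fW: "x \<in> W \<Longrightarrow> f x \<in> W" for x using f by (auto simp: bij_betw_def)
    have "card {w\<in>W. g w = l} = card {w\<in>W. h w = l}" for l
    proof -
      have "f ` {w\<in>W. h w = l} = {w\<in>W. g w = l}"
        using f by (auto simp: h_def bij_betw_def)
      moreover have "inj_on f {w\<in>W. h w = l}"
        using f by (auto simp: bij_betw_def intro: inj_on_subset)
      ultimately show ?thesis using card_image[of f "{w\<in>W. h w = l}"] by simp
    qed
    moreover have "h v \<le> r" if "v \<in> V" for v
      using g fW i k by (auto simp: h_def W_def facet_def admissible_def)
    moreover have "h v \<noteq> 0" if "v \<in> U" for v
      using that i k by (auto simp: h_def W_def)
    ultimately have "facet h \<and> movable h = U"
      using facet_reachable[of g U h] g by (auto simp: U_def W_def)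
    moreover have "fib h i = B \<union> X"
      using fB B X UV k by (auto simp: fib_def h_def W_def)
    ultimately show ?thesis by blast
  qed
  have mW: "m i \<le> card W" for i
    unfolding m_def using finW by (intro card_mono) auto
  have "K i = {B. B \<subseteq> V \<and> card (B - U) \<le> m i}" if i: "i \<in> {1..r}" for i
  proof (intro set_eqI iffI CollectI conjI)
    fix B assume "B \<in> {B. B \<subseteq> V \<and> card (B - U) \<le> m i}"
    then have B: "B \<subseteq> V" "card (B - U) \<le> m i" by auto
    have "B - U \<subseteq> W" using B by (auto simp: W_def)
    then obtain B' where B': "B - U \<subseteq> B'" "B' \<subseteq> W" "card B' = m i"
      using exists_subset_between[of "B - U" "m i" W] B mW finW by blast
    obtain h where "facet h" "fib h i = B' \<union> U" using prescribe[OF i B'(2,3), of U] by auto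
    then have "B' \<union> U \<in> K i" using facet_fib i by metis
    then show "B \<in> K i" using down_closed[OF i, of "B' \<union> U" B] B' by blast
  next
    fix B assume B: "B \<in> K i"
    then show BV: "B \<subseteq> V" using subset_V i by blast
    show "card (B - U) \<le> m i"
    proof (rule ccontr)
      assume *: "\<not> card (B - U) \<le> m i"
      then obtain B' where B': "B' \<subseteq> B - U" "card B' = m i"
        using obtain_subset_with_card_n[of "m i" "B - U"] by auto
      then have "B' \<noteq> B - U" using * by auto
      then obtain x where x: "x \<in> B - U" "x \<notin> B'" using B' by blast
      \<comment> \<open>A facet whose class \<open>i\<close> is exactly \<open>B'\<close> cannot
        accept the unmovable \<open>x\<close>, although \<open>insert x B'\<close> lies inside
        \<open>B\<close>.\<close>
      obtain h where h: "facet h" "movable h = U" "fib h i = B'"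
        using prescribe[OF i _ B'(2), of "{}"] B' BV by (auto simp: W_def)
      have "insert x (fib h i) \<notin> K i"
        using not_movable_maximal[of h x i] h x i BV by (auto simp: fib_def)
      moreover have "insert x (fib h i) \<in> K i"
        using down_closed[OF i B, of "insert x B'"] h x B' by auto
      ultimately show False by blast
    qed
  qed
  then show ?thesis using UV cardW unfolding W_def by blast
qed

end

section \<open>Deleted joins, chessboards and joins of points\<close>

lemma complex_isoI:
  assumes f: "bij_betw f V W" and "K \<subseteq> Pow V" "L \<subseteq> Pow W"
    and iff: "\<And>S. S \<subseteq> V \<Longrightarrow> S \<in> K \<longleftrightarrow> f ` S \<in> L"
  shows "complex_iso V K W L"
proof -
  have "T \<in> (\<lambda>S. f ` S) ` K" if "T \<in> L" for T
  proof -
    have "T \<subseteq> f ` V" using that assms by (auto simp: bij_betw_def)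
    then obtain S where "S \<subseteq> V" "T = f ` S" by (meson subset_imageE)
    then show ?thesis using iff that by blast
  qed
  moreover have "f ` S \<in> L" if "S \<in> K" for S
    using that assms by blast
  ultimately have "(\<lambda>S. f ` S) ` K = L" by blast
  with f show ?thesis unfolding complex_iso_def by blast
qed

text \<open>The family \<open>A\<close> is recovered from the slices of \<open>S\<close>, and
  disjointness becomes uniqueness of the colour. \<open>chessboard_iff\<close> and
  \<open>join_power_isolated_points_iff\<close> bring the other complexes to the same form.\<close>

lemma deleted_join_iff:
  assumes "\<And>i. i \<in> {1..r} \<Longrightarrow> K i \<subseteq> Pow V"
  shows "S \<in> deleted_join r K \<longleftrightarrow> S \<subseteq> V \<times> {1..r} \<and> (\<forall>i\<in>{1..r}. {v. (v, i) \<in> S} \<in> K i) \<and>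
    (\<forall>v i j. (v, i) \<in> S \<longrightarrow> (v, j) \<in> S \<longrightarrow> i = j)" (is "_ \<longleftrightarrow> ?R")
proof
  assume "S \<in> deleted_join r K"
  then obtain A where S: "S = (\<Union>i\<in>{1..r}. A i \<times> {i})"
    and A: "\<forall>i\<in>{1..r}. A i \<in> K i" "disjoint_family_on A {1..r}"
    by (auto simp: deleted_join_def)
  have "{v. (v, i) \<in> S} = A i" if "i \<in> {1..r}" for i using that S by auto
  then have "\<forall>i\<in>{1..r}. {v. (v, i) \<in> S} \<in> K i" using A by simp
  moreover have "S \<subseteq> V \<times> {1..r}" using S A(1) assms by blast
  moreover have "i = j" if "(v, i) \<in> S" "(v, j) \<in> S" for v i j
    using that A(2) unfolding S disjoint_family_on_def by blast
  ultimately show ?R by blast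
next
  assume R: ?R
  let ?A = "\<lambda>i. {v. (v, i) \<in> S}"
  have "S = (\<Union>i\<in>{1..r}. ?A i \<times> {i})" using R by auto
  moreover have "disjoint_family_on ?A {1..r}" using R by (auto simp: disjoint_family_on_def)
  ultimately show "S \<in> deleted_join r K"
    unfolding deleted_join_def using R by (intro CollectI exI[of _ ?A] conjI) simp_all
qed

lemma chessboard_iff:
  "S \<in> chessboard n r m \<longleftrightarrow> S \<subseteq> {1..n} \<times> {1..r} \<and>
     (\<forall>i\<in>{1..r}. card {x. (x, i) \<in> S} \<le> m i) \<and>
     (\<forall>x i j. (x, i) \<in> S \<longrightarrow> (x, j) \<in> S \<longrightarrow> i = j)"
proof (cases "S \<subseteq> {1..n} \<times> {1..r}")
  case True
  have "card (S \<inter> ({1..n} \<times> {i})) = card {x. (x, i) \<in> S}" for i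
  proof -
    have "S \<inter> ({1..n} \<times> {i}) = (\<lambda>x. (x, i)) ` {x. (x, i) \<in> S}" using True by auto
    then show ?thesis by (simp add: card_image inj_on_def)
  qed
  moreover have "(\<forall>x\<in>{1..n}. card (S \<inter> ({x} \<times> {1..r})) \<le> 1) \<longleftrightarrow>
      (\<forall>x i j. (x, i) \<in> S \<longrightarrow> (x, j) \<in> S \<longrightarrow> i = j)"
  proof -
    have "card (S \<inter> ({x} \<times> {1..r})) \<le> 1 \<longleftrightarrow> (\<forall>i j. (x, i) \<in> S \<longrightarrow> (x, j) \<in> S \<longrightarrow> i = j)" for x
    proof -
      have "finite (S \<inter> ({x} \<times> {1..r}))" by simp
      then show ?thesis
        using True by (auto simp: card_le_Suc0_iff_eq subset_iff Ball_def)
    qed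
    then show ?thesis using True by blast
  qed
  ultimately show ?thesis using True by (simp add: chessboard_def)
qed (auto simp: chessboard_def)

text \<open>A simplex of \<open>isolated_points r\<close> has at most one vertex, so each copy
  chooses at most one colour. The colour is the first coordinate here, unlike in the deleted
  join.\<close>

lemma join_power_isolated_points_iff:
  "T \<in> join_power (isolated_points r) k \<longleftrightarrow> T \<subseteq> {1..r} \<times> {1..k} \<and>
     (\<forall>x i j. (i, x) \<in> T \<longrightarrow> (j, x) \<in> T \<longrightarrow> i = j)" (is "_ \<longleftrightarrow> ?R")
proof
  assume "T \<in> join_power (isolated_points r) k"
  then obtain B where "T = (\<Union>j\<in>{1..k}. B j \<times> {j})" "\<forall>j\<in>{1..k}. B j \<in> isolated_points r"
    by (auto simp: join_power_def)
  then show ?R by (fastforce simp: isolated_points_def)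
next
  assume R: ?R
  let ?B = "\<lambda>x. {i. (i, x) \<in> T}"
  have "?B x \<in> isolated_points r" for x
  proof (cases "?B x = {}")
    case False
    then obtain i where "(i, x) \<in> T" by blast
    then have "?B x = {i}" "i \<in> {1..r}" using R by auto
    then show ?thesis by (simp add: isolated_points_def)
  qed (simp add: isolated_points_def)
  moreover have "T = (\<Union>x\<in>{1..k}. ?B x \<times> {x})" using R by auto
  ultimately show "T \<in> join_power (isolated_points r) k"
    unfolding join_power_def by (intro CollectI exI[of _ ?B] conjI ballI)
qed

lemma complex_join_iff: "X \<in> complex_join K L \<longleftrightarrow> Inl -` X \<in> K \<and> Inr -` X \<in> L"
proof
  assume "X \<in> complex_join K L"
  then obtain A B where "X = A <+> B" "A \<in> K" "B \<in> L" by (auto simp: complex_join_def)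
  moreover have "Inl -` (A <+> B) = A" "Inr -` (A <+> B) = B" by auto
  ultimately show "Inl -` X \<in> K \<and> Inr -` X \<in> L" by simp
next
  assume "Inl -` X \<in> K \<and> Inr -` X \<in> L"
  moreover have "X = Inl -` X <+> Inr -` X"
    by (auto simp: Plus_def image_iff) (metis sum.exhaust)
  ultimately show "X \<in> complex_join K L" unfolding complex_join_def by blast
qed

text \<open>The bound on \<open>B - U\<close> ignores \<open>U\<close>: the vertices outside
  \<open>U\<close> form the chessboard, while each vertex of \<open>U\<close> is constrained only to
  have at most one colour, which is a factor \<open>[r]\<close>.\<close>

lemma deleted_join_iso_join:
  assumes "U \<subseteq> V"
    and e: "bij_betw e (V - U) {1..n}" and f: "bij_betw f U {1..k}"
    and K: "\<forall>i\<in>{1..r}. K i = {B. B \<subseteq> V \<and> card (B - U) \<le> m i}"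
  shows "complex_iso (V \<times> {1..r}) (deleted_join r K)
    (({1..n} \<times> {1..r}) <+> ({1..r} \<times> {1..k}))
    (complex_join (chessboard n r m) (join_power (isolated_points r) k))"
proof (rule complex_isoI)
  let ?F = "\<lambda>(v, i). if v \<in> U then Inr (i, f v) else Inl (e v, i)"
  have ei: "e x = e y \<longleftrightarrow> x = y" if "x \<in> V - U" "y \<in> V - U" for x y
    using e that by (auto simp: bij_betw_def inj_on_def)
  have fi: "f x = f y \<longleftrightarrow> x = y" if "x \<in> U" "y \<in> U" for x y
    using f that by (auto simp: bij_betw_def inj_on_def)
  have er: "x \<in> V - U \<Longrightarrow> e x \<in> {1..n}" and fr: "x \<in> U \<Longrightarrow> f x \<in> {1..k}" for x
    using e f by (auto simp: bij_betw_def)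
  show "bij_betw ?F (V \<times> {1..r}) (({1..n} \<times> {1..r}) <+> ({1..r} \<times> {1..k}))"
  proof (rule bij_betw_imageI)
    show "inj_on ?F (V \<times> {1..r})"
      by (rule inj_onI) (auto simp: ei fi split: if_splits)
    show "?F ` (V \<times> {1..r}) = ({1..n} \<times> {1..r}) <+> ({1..r} \<times> {1..k})" (is "?A = ?B")
    proof
      show "?A \<subseteq> ?B" using er fr by fastforce
      show "?B \<subseteq> ?A"
      proof
        fix z assume "z \<in> ?B"
        then consider x i where "z = Inl (x, i)" "x \<in> {1..n}" "i \<in> {1..r}"
          | x i where "z = Inr (i, x)" "x \<in> {1..k}" "i \<in> {1..r}" by auto
        then show "z \<in> ?A"
        proof cases
          case 1
          then obtain v where "v \<in> V - U" "e v = x" using e by (metis bij_betw_def imageE)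
          then show ?thesis using 1 by (intro image_eqI[of _ _ "(v, i)"]) auto
        next
          case 2
          then obtain v where "v \<in> U" "f v = x" using f by (metis bij_betw_def imageE)
          then show ?thesis using 2 \<open>U \<subseteq> V\<close> by (intro image_eqI[of _ _ "(v, i)"]) auto
        qed
      qed
    qed
  qed
  have KV: "\<And>i. i \<in> {1..r} \<Longrightarrow> K i \<subseteq> Pow V" using K by auto
  show "deleted_join r K \<subseteq> Pow (V \<times> {1..r})"
    using deleted_join_iff[of r K V, OF KV] by blast
  show "complex_join (chessboard n r m) (join_power (isolated_points r) k)
      \<subseteq> Pow (({1..n} \<times> {1..r}) <+> ({1..r} \<times> {1..k}))"
    unfolding complex_join_def using chessboard_iff join_power_isolated_points_iff by blast
  show "S \<in> deleted_join r K \<longleftrightarrow>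
      ?F ` S \<in> complex_join (chessboard n r m) (join_power (isolated_points r) k)"
    if S: "S \<subseteq> V \<times> {1..r}" for S
  proof -
    \<comment> \<open>\<open>P\<close> and \<open>Q\<close> are the chessboard part and the
      join-power part of the image of \<open>S\<close>.\<close>
    define P where "P = Inl -` (?F ` S)"
    define Q where "Q = Inr -` (?F ` S)"
    have P: "z \<in> P \<longleftrightarrow> (\<exists>v i. (v, i) \<in> S \<and> v \<notin> U \<and> z = (e v, i))" for z
      by (auto simp: P_def image_iff Bex_def split: if_splits)
    have Q: "z \<in> Q \<longleftrightarrow> (\<exists>v i. (v, i) \<in> S \<and> v \<in> U \<and> z = (i, f v))" for z
      by (auto simp: Q_def image_iff Bex_def split: if_splits)
    have VR: "v \<in> V \<and> i \<in> {1..r}" if "(v, i) \<in> S" for v i using S that by auto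
    have Psub: "P \<subseteq> {1..n} \<times> {1..r}" and Qsub: "Q \<subseteq> {1..r} \<times> {1..k}"
      using VR er fr by (auto simp: P Q simp del: atLeastAtMost_iff)
    have card_eq: "card ({v. (v, i) \<in> S} - U) = card {x. (x, i) \<in> P}" for i
    proof -
      have "{x. (x, i) \<in> P} = e ` ({v. (v, i) \<in> S} - U)" by (auto simp: P)
      moreover have "inj_on e ({v. (v, i) \<in> S} - U)"
        using S e by (auto simp: bij_betw_def intro!: inj_on_subset[of e "V - U"])
      ultimately show ?thesis by (simp add: card_image)
    qed
    have "S \<in> deleted_join r K \<longleftrightarrow> (\<forall>i\<in>{1..r}. card ({v. (v, i) \<in> S} - U) \<le> m i) \<and>
        (\<forall>v i j. (v, i) \<in> S \<longrightarrow> (v, j) \<in> S \<longrightarrow> i = j)"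
      using deleted_join_iff[of r K V S, OF KV] K S by auto
    moreover have "(\<forall>v i j. (v, i) \<in> S \<longrightarrow> (v, j) \<in> S \<longrightarrow> i = j) \<longleftrightarrow>
        (\<forall>x i j. (x, i) \<in> P \<longrightarrow> (x, j) \<in> P \<longrightarrow> i = j) \<and>
        (\<forall>x i j. (i, x) \<in> Q \<longrightarrow> (j, x) \<in> Q \<longrightarrow> i = j)" (is "?L \<longleftrightarrow> ?M")
    proof
      assume L: ?L
      show ?M using L VR ei fi unfolding P Q by (smt (verit) DiffI prod.inject)
    next
      assume M: ?M
      show ?L
      proof (intro allI impI)
        fix v i j assume vS: "(v, i) \<in> S" "(v, j) \<in> S"
        show "i = j"
        proof (cases "v \<in> U")
          case True
          then have "(i, f v) \<in> Q" "(j, f v) \<in> Q" using vS Q by blast+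
          then show ?thesis using M by blast
        next
          case False
          then have "(e v, i) \<in> P" "(e v, j) \<in> P" using vS P by blast+
          then show ?thesis using M by blast
        qed
      qed
    qed
    ultimately show ?thesis
      using Psub Qsub card_eq
      by (simp add: complex_join_iff chessboard_iff join_power_isolated_points_iff
          flip: P_def Q_def)
  qed
qed

lemma join_power_0: "join_power L 0 = {{}}"
  by (auto simp: join_power_def)

text \<open>Serves the case of empty \<open>U\<close>, where the second join factor has no vertices
  and only the sum type has to be removed.\<close>

lemma complex_iso_join_empty:
  fixes K :: "'a set set" and W :: "'b set"
  assumes "complex_iso V K (W <+> ({} :: 'c set)) (complex_join L {{}})"
  shows "complex_iso V K W L"
proof -
  obtain f :: "'a \<Rightarrow> 'b + 'c" where f: "bij_betw f V (W <+> {})" "(\<lambda>S. f ` S) ` K = complex_join L {{}}"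
    using assms by (auto simp: complex_iso_def)
  have "bij_betw projl (W <+> {}) W"
    by (rule bij_betw_byWitness[where f' = Inl]) auto
  with f(1) have "bij_betw (projl \<circ> f) V W" by (rule bij_betw_trans)
  moreover have "(\<lambda>S. (projl \<circ> f) ` S) ` K = (\<lambda>T. projl ` T) ` complex_join L ({{}} :: 'c set set)"
    unfolding f(2)[symmetric] by (simp add: image_image comp_def)
  moreover have "(\<lambda>T. projl ` T) ` complex_join L ({{}} :: 'c set set) = L"
  proof -
    have "projl ` (A <+> ({} :: 'c set)) = A" for A :: "'b set" by force
    moreover have "complex_join L ({{}} :: 'c set set) = (\<lambda>A. A <+> {}) ` L" by (auto simp: complex_join_def)
    ultimately show ?thesis by (simp add: image_image)
  qed
  ultimately show ?thesis unfolding complex_iso_def by metis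
qed

section \<open>Two complexes, and the classification\<close>

text \<open>Both inclusions come from the complementary pair \<open>V - F\<close>, \<open>F\<close>:
  unavoidability puts one of the two into its complex, and the cardinality condition excludes both,
  since together they leave no vertex.\<close>

lemma alexander_pair_dual:
  assumes "simplicial_complex_on V (K 1)" "simplicial_complex_on V (K 2)" "alexander_tuple V 2 K"
  shows "K 2 = alexander_dual V (K 1)"
proof -
  have r: "{1..2} = {1, 2::nat}" by auto
  have *: "V - (A \<union> B) \<noteq> {}" if "A \<in> K 1" "B \<in> K 2" for A B
  proof -
    have "\<forall>C. (\<forall>i\<in>{1,2}. C i \<in> K i) \<longrightarrow> 1 \<le> card (V - (\<Union>i\<in>{1,2}. C i))"
      using assms(3) unfolding alexander_tuple_def r by simp
    from spec[OF this, of "\<lambda>i. if i = 1 then A else B"] have "1 \<le> card (V - (A \<union> B))"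
      using that by (auto simp: Un_commute)
    then show ?thesis by (metis card.empty not_one_le_zero)
  qed
  have **: "A \<in> K 1 \<or> B \<in> K 2" if "A \<subseteq> V" "B \<subseteq> V" "A \<inter> B = {}" for A B
  proof -
    have "\<forall>C. (\<forall>i\<in>{1,2}. C i \<subseteq> V) \<and> disjoint_family_on C {1,2} \<longrightarrow> (\<exists>i\<in>{1,2}. C i \<in> K i)"
      using assms(3) unfolding alexander_tuple_def collective_unavoidable_def r by blast
    from spec[OF this, of "\<lambda>i. if i = 1 then A else B"] show ?thesis
      using that by (auto simp: disjoint_family_on_def)
  qed
  have "F \<subseteq> V" if "F \<in> K 2" for F using that assms by (auto simp: simplicial_complex_on_def)
  then show ?thesis
    using * **[of "V - F" F for F] unfolding alexander_dual_def by blast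
qed

lemma ex_bij_betw_finite_interval: "finite M \<Longrightarrow> \<exists>h. bij_betw h M {1..card M}"
  by (rule finite_same_card_bij) simp_all

lemma deleted_join_cong:
  "(\<And>i. i \<in> {1..r} \<Longrightarrow> K i = L i) \<Longrightarrow> deleted_join r K = deleted_join r L"
  unfolding deleted_join_def by simp

text \<open>For \<open>r = 0\<close> there is no index to supply; for \<open>r = 1\<close>
  unavoidability puts \<open>V\<close> into \<open>K 1\<close>, against properness.\<close>

lemma alexander_tuple_size:
  assumes "\<forall>i\<in>{1..r}. proper_complex_on V (K i)" "alexander_tuple V r K"
  shows "2 \<le> r"
proof (rule ccontr)
  have un: "\<exists>i\<in>{1..r}. A i \<in> K i"
    if "\<forall>i\<in>{1..r}. A i \<subseteq> V" "disjoint_family_on A {1..r}" for A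
    using assms(2) that unfolding alexander_tuple_def collective_unavoidable_def by blast
  assume "\<not> 2 \<le> r"
  then consider "r = 0" | "r = 1" by linarith
  then show False
  proof cases
    case 1
    then show False using un[of "\<lambda>_. {}"] by (simp add: disjoint_family_on_def)
  next
    case 2
    then have "V \<in> K 1" using un[of "\<lambda>_. V"] by (auto simp: disjoint_family_on_def)
    then show False
      using assms(1) 2 by (auto simp: proper_complex_on_def simplicial_complex_on_def)
  qed
qed

theorem corollary5p2:
  fixes V :: "'a set" and r :: nat and K :: "nat \<Rightarrow> 'a set set"
  assumes "finite V"
    and "\<forall>i\<in>{1..r}. proper_complex_on V (K i)"
    and "alexander_tuple V r K"
  shows "(r = 2 \<and>
           (\<exists>L. proper_complex_on V L \<and>
                complex_iso (V \<times> {1..r}) (deleted_join r K) (V \<times> {1..2}) (bier_sphere V L))) \<or>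
         (r \<ge> 3 \<and>
           (\<exists>n m. n = (\<Sum>i=1..r. m i) + r - 1 \<and>
                complex_iso (V \<times> {1..r}) (deleted_join r K)
                  ({1..n} \<times> {1..r}) (chessboard n r m))) \<or>
         (r \<ge> 3 \<and>
           (\<exists>n m k. n = (\<Sum>i=1..r. m i) + r - 1 \<and> k \<ge> 1 \<and>
                complex_iso (V \<times> {1..r}) (deleted_join r K)
                  (({1..n} \<times> {1..r}) <+> ({1..r} \<times> {1..k}))
                  (complex_join (chessboard n r m) (join_power (isolated_points r) k))))"
proof -
  have complexes: "simplicial_complex_on V (K i)" if "i \<in> {1..r}" for i
    using assms(2) that by (auto simp: proper_complex_on_def)
  consider "r = 2" | "3 \<le> r" using alexander_tuple_size[OF assms(2,3)] by linarith
  then show ?thesis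
  proof cases
    case 1
    have "K 2 = alexander_dual V (K 1)"
      using alexander_pair_dual[of V K] complexes assms(3) 1 by simp
    then have "deleted_join r K = bier_sphere V (K 1)"
      unfolding bier_sphere_def 1
      by (intro deleted_join_cong) (auto simp: le_Suc_eq numeral_2_eq_2)
    then have "complex_iso (V \<times> {1..r}) (deleted_join r K) (V \<times> {1..2}) (bier_sphere V (K 1))"
      unfolding complex_iso_def 1 by (intro exI[of _ id]) simp
    then show ?thesis using 1 assms(2) by (intro disjI1 conjI exI[of _ "K 1"]) auto
  next
    case 2
    then have "alexander V r K"
      using assms(1,3) complexes by (intro alexander.intro)
    from alexander.tuple_structure[OF this] obtain U m where U: "U \<subseteq> V" and card: "card (V - U) = (\<Sum>i=1..r. m i) + r - 1"
      and K: "\<forall>i\<in>{1..r}. K i = {B. B \<subseteq> V \<and> card (B - U) \<le> m i}"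
      by (elim exE conjE)
    define n where "n = card (V - U)"
    define k where "k = card U"
    obtain e where e: "bij_betw e (V - U) {1..n}"
      using ex_bij_betw_finite_interval[OF finite_Diff[OF assms(1)]] unfolding n_def by (rule exE)
    obtain f where f: "bij_betw f U {1..k}"
      using ex_bij_betw_finite_interval[OF finite_subset[OF U assms(1)]] unfolding k_def by (rule exE)
    note iso = deleted_join_iso_join[OF U e f K]
    show ?thesis
    \<comment> \<open>If \<open>U\<close> is empty the join power is \<open>{{}}\<close> and the
      chessboard alone remains; otherwise \<open>card U\<close> is the number of factors
      \<open>[r]\<close>.\<close>
    proof (cases "k = 0")
      case True
      have no_vertices: "{1..r} \<times> {1..0} = ({} :: (nat \<times> nat) set)" by simp
      have "complex_iso (V \<times> {1..r}) (deleted_join r K)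
          (({1..n} \<times> {1..r}) <+> ({} :: (nat \<times> nat) set)) (complex_join (chessboard n r m) {{}})"
        using iso unfolding True join_power_0 no_vertices .
      then have iso0: "complex_iso (V \<times> {1..r}) (deleted_join r K)
          ({1..n} \<times> {1..r}) (chessboard n r m)"
        by (rule complex_iso_join_empty)
      show ?thesis
        by (rule disjI2, rule disjI1, rule conjI[OF 2], rule exI[of _ n], rule exI[of _ m])
           (intro conjI card[folded n_def] iso0)
    next
      case False
      then have k: "1 \<le> k" by simp
      show ?thesis
        by (rule disjI2, rule disjI2, rule conjI[OF 2], rule exI[of _ n],
            rule exI[of _ m], rule exI[of _ k]) (intro conjI card[folded n_def] k iso)
    qed
  qed
qed

end
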